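(* Let $\alpha$ and $\gamma$ be finite bit strings (possibly of different lengths). If $\alpha\succcurlyeq\gamma$, then $\alpha\succcurlyeq_{\mathrm{fst}}\gamma$.
   Context: Reliability polynomials: $I(x)=x$ for the empty string, $I_0(x)=x^2$, $I_1(x)=1-(1-x)^2$, and $I_{a_1a_2\cdots a_\ell}(x)=I_{a_2\cdots a_\ell}(I_{a_1}(x))$ for $a_1\cdots a_\ell\in\{0,1\}^\ell$. Write $\alpha\succcurlyeq\gamma$ if $I_\alpha(x)\ge I_\gamma(x)$ for all $x\in[0,1]$. $\bar\alpha$ denotes the bitwise complement of $\alpha$. Exponent and mantissa: for a nonzero polynomial $f$ of degree at most $n$, write $f(x)=\sum_{i=0}^n N_i x^i(1-x)^{n-i}$; the exponent of $f$ is the smallest $i$ with $N_i\ne0$ and the mantissa of $f$ is the value of $N_i$ at that index (neither depends on $n$). Write $\alpha\sim_{@0}\gamma$ if $I_\alpha$ and $I_\gamma$ have the same exponent and the same mantissa. Write $\alpha>_{@0}\gamma$ (equivalently $\gamma<_{@0}\alpha$) if $I_\alpha$ has a smaller exponent than $I_\gamma$, or they have the same exponent and $I_\alpha$ has a larger mantissa. Write $\alpha\sim_{@1}\gamma$ if $\bar\alpha\sim_{@0}\bar\gamma$, and $\alpha>_{@1}\gamma$ if $\bar\alpha<_{@0}\bar\gamma$. Halfway point: $\mathrm{hlf}(\alpha)=I_\alpha^{-1}(1/2)$, where $I_\alpha$ is regarded as an increasing bijection of $[0,1]$; write $\alpha\ge_{\mathrm{hlf}}\gamma$ if $\mathrm{hlf}(\alpha)\le\mathrm{hlf}(\gamma)$.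 Finally, $\alpha\succcurlyeq_{\mathrm{fst}}\gamma$ means that all three hold: (i) $\alpha>_{@0}\gamma$ or $\alpha\sim_{@0}\gamma$; (ii) $\alpha>_{@1}\gamma$ or $\alpha\sim_{@1}\gamma$; (iii) $\alpha\ge_{\mathrm{hlf}}\gamma$. *)

theory Defs
  imports "HOL-Computational_Algebra.Polynomial"
begin

text \<open>Bit strings are boolean lists: \<open>False\<close> is the bit 0 and \<open>True\<close> the bit 1.\<close>

type_synonym bits = "bool list"

definition I_bit :: "bool \<Rightarrow> real poly" where
  "I_bit a = (if a then 1 - (1 - [:0, 1:])^2 else [:0, 1:]^2)"

primrec I_poly :: "bits \<Rightarrow> real poly" where
  "I_poly [] = [:0, 1:]"
| "I_poly (a # as) = pcompose (I_poly as) (I_bit a)"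

definition complement :: "bits \<Rightarrow> bits" where
  "complement \<alpha> = map Not \<alpha>"

definition rel_ge :: "bits \<Rightarrow> bits \<Rightarrow> bool" where
  "rel_ge \<alpha> \<gamma> \<longleftrightarrow> (\<forall>x\<in>{0..1}. poly (I_poly \<alpha>) x \<ge> poly (I_poly \<gamma>) x)"

definition expansion :: "nat \<Rightarrow> (nat \<Rightarrow> real) \<Rightarrow> real poly \<Rightarrow> bool" where
  "expansion n N f \<longleftrightarrow> f = (\<Sum>i\<le>n. smult (N i) ([:0, 1:]^i * (1 - [:0, 1:])^(n - i)))"

definition has_exponent_mantissa :: "real poly \<Rightarrow> nat \<Rightarrow> real \<Rightarrow> bool" where
  "has_exponent_mantissa f e m \<longleftrightarrow>
     (\<exists>n N. degree f \<le> n \<and> expansion n N f \<and>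
        e \<le> n \<and> N e \<noteq> 0 \<and> (\<forall>i<e. N i = 0) \<and> m = N e)"

definition exponent :: "real poly \<Rightarrow> nat" where
  "exponent f = (THE e. \<exists>m. has_exponent_mantissa f e m)"

definition mantissa :: "real poly \<Rightarrow> real" where
  "mantissa f = (THE m. \<exists>e. has_exponent_mantissa f e m)"

text \<open>
  A nonzero polynomial has, for every admissible \<open>n\<close>, an expansion with a nonzero coefficient,
  and the exponent and mantissa read off from it do not depend on \<open>n\<close>; so the descriptions
  above are proper.
\<close>

lemma smult_sum_right: "smult c (\<Sum>i\<in>S. p i) = (\<Sum>i\<in>S. smult c (p i))"
  by (induct S rule: infinite_finite_induct) (auto simp: smult_add_right)

lemma expansion_exists:
  assumes "degree f \<le> n"
  shows "\<exists>N. expansion n N f"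
proof -
  have monom: "\<exists>N. expansion n N (monom c k)" if "k \<le> n" for c k
  proof -
    have "monom c k = smult c ([:0, 1:]^k * ([:0, 1:] + (1 - [:0, 1:]))^(n - k))"
      by (simp add: monom_altdef)
    also have "\<dots> = smult c (\<Sum>j\<le>n - k. of_nat ((n - k) choose j) *
        ([:0, 1:]^(k + j) * (1 - [:0, 1:])^(n - (k + j))))"
      unfolding binomial_ring sum_distrib_left
      by (intro arg_cong[where f = "smult c"] sum.cong) (simp_all add: power_add mult_ac)
    also have "\<dots> = (\<Sum>j\<le>n - k. smult (c * of_nat ((n - k) choose j))
        ([:0, 1:]^(k + j) * (1 - [:0, 1:])^(n - (k + j))))"
      by (simp add: smult_sum_right of_nat_poly)
    also have "\<dots> = (\<Sum>i\<in>{k..n}. smult (c * of_nat ((n - k) choose (i - k)))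
        ([:0, 1:]^i * (1 - [:0, 1:])^(n - i)))"
      by (rule sum.reindex_bij_witness[where i = "\<lambda>i. i - k" and j = "\<lambda>j. k + j"])
        (use that in auto)
    also have "\<dots> = (\<Sum>i\<le>n. smult (if k \<le> i then c * of_nat ((n - k) choose (i - k)) else 0)
        ([:0, 1:]^i * (1 - [:0, 1:])^(n - i)))"
      by (rule sum.mono_neutral_cong_left) auto
    finally show ?thesis unfolding expansion_def
      by (rule exI[where x = "\<lambda>i. if k \<le> i then c * of_nat ((n - k) choose (i - k)) else 0"])
  qed
  have "\<forall>k. \<exists>N. k \<le> n \<longrightarrow> expansion n N (monom (coeff f k) k)"
    using monom by blast
  then obtain N where N: "k \<le> n \<Longrightarrow> expansion n (N k) (monom (coeff f k) k)" for k
    by metis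
  have "f = (\<Sum>k\<le>n. monom (coeff f k) k)"
    using assms by (simp add: poly_as_sum_of_monoms')
  also have "\<dots> = (\<Sum>k\<le>n. \<Sum>i\<le>n. smult (N k i) ([:0, 1:]^i * (1 - [:0, 1:])^(n - i)))"
    using N by (intro sum.cong) (auto simp: expansion_def)
  also have "\<dots> = (\<Sum>i\<le>n. smult (\<Sum>k\<le>n. N k i) ([:0, 1:]^i * (1 - [:0, 1:])^(n - i)))"
    by (subst sum.swap) (simp add: smult_sum)
  finally show ?thesis unfolding expansion_def
    by (rule exI[where x = "\<lambda>i. \<Sum>k\<le>n. N k i"])
qed

lemma has_exponent_mantissa_exists:
  assumes "f \<noteq> 0" "degree f \<le> n"
  shows "\<exists>N e. expansion n N f \<and> e \<le> n \<and> N e \<noteq> 0 \<and> (\<forall>i<e. N i = 0)"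
proof -
  obtain N where N: "expansion n N f"
    using expansion_exists assms(2) by blast
  have "\<exists>i. i \<le> n \<and> N i \<noteq> 0"
  proof (rule ccontr)
    assume "\<not> ?thesis"
    then have "f = 0" using N by (simp add: expansion_def)
    with assms(1) show False ..
  qed
  then obtain e where "e \<le> n \<and> N e \<noteq> 0" "\<forall>i<e. \<not> (i \<le> n \<and> N i \<noteq> 0)"
    using exists_least_iff[of "\<lambda>i. i \<le> n \<and> N i \<noteq> 0"] by blast
  with N show ?thesis by (metis less_imp_le less_le_trans)
qed

lemma has_exponent_mantissa_coeff:
  assumes "has_exponent_mantissa f e m"
  shows "coeff f e = m" "m \<noteq> 0" "\<forall>i<e. coeff f i = 0"
proof -
  obtain n N where f: "expansion n N f" and e: "e \<le> n" "N e \<noteq> 0" "\<forall>i<e. N i = 0" "m = N e"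
    using assms unfolding has_exponent_mantissa_def by blast
  have c: "coeff ([:0, 1:]^i * (1 - [:0, 1:])^j :: real poly) k
      = (if k < i then 0 else if k = i then 1 else coeff ((1 - [:0, 1:])^j) (k - i))" for i j k
  proof -
    have "[:0, 1:]^i = (monom 1 i :: real poly)" by (simp add: monom_altdef)
    moreover have "coeff ((1 - [:0, 1:])^j :: real poly) 0 = 1"
      by (simp add: coeff_0_power)
    ultimately show ?thesis
      by (auto simp: coeff_monom_mult)
  qed
  have z: "coeff f k = (if k = e then N e else 0)" if "k \<le> e" for k
  proof -
    have "coeff f k = (\<Sum>i\<le>n. N i * coeff ([:0, 1:]^i * (1 - [:0, 1:])^(n - i)) k)"
      using f by (simp add: expansion_def coeff_sum)
    also have "\<dots> = (\<Sum>i\<le>n. if i = e then (if k = e then N e else 0) else 0)"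
    proof (intro sum.cong refl)
      fix i
      show "N i * coeff ([:0, 1:]^i * (1 - [:0, 1:])^(n - i)) k
          = (if i = e then (if k = e then N e else 0) else 0)"
        using that e(3) by (cases i e rule: linorder_cases) (simp_all add: c)
    qed
    also have "\<dots> = (if k = e then N e else 0)" using e(1) by simp
    finally show ?thesis .
  qed
  show "coeff f e = m" "m \<noteq> 0" "\<forall>i<e. coeff f i = 0"
    using z e by auto
qed

lemma has_exponent_mantissa_unique:
  assumes "has_exponent_mantissa f e m" "has_exponent_mantissa f e' m'"
  shows "e = e'" "m = m'"
proof -
  note 1 = has_exponent_mantissa_coeff[OF assms(1)]
    and 2 = has_exponent_mantissa_coeff[OF assms(2)]
  show "e = e'" using 1 2 by (metis linorder_neqE_nat)
  with 1 2 show "m = m'" by simp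
qed

lemma ex1_exponent: "f \<noteq> 0 \<Longrightarrow> \<exists>!e. \<exists>m. has_exponent_mantissa f e m"
  and ex1_mantissa: "f \<noteq> 0 \<Longrightarrow> \<exists>!m. \<exists>e. has_exponent_mantissa f e m"
proof -
  assume "f \<noteq> 0"
  then obtain e m where em: "has_exponent_mantissa f e m"
    using has_exponent_mantissa_exists[OF _ order_refl]
    unfolding has_exponent_mantissa_def by blast
  show "\<exists>!e. \<exists>m. has_exponent_mantissa f e m" "\<exists>!m. \<exists>e. has_exponent_mantissa f e m"
    using em has_exponent_mantissa_unique by metis+
qed

definition sim0 :: "bits \<Rightarrow> bits \<Rightarrow> bool" where
  "sim0 \<alpha> \<gamma> \<longleftrightarrow>
     exponent (I_poly \<alpha>) = exponent (I_poly \<gamma>) \<and> mantissa (I_poly \<alpha>) = mantissa (I_poly \<gamma>)"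

definition gt0 :: "bits \<Rightarrow> bits \<Rightarrow> bool" where
  "gt0 \<alpha> \<gamma> \<longleftrightarrow>
     exponent (I_poly \<alpha>) < exponent (I_poly \<gamma>) \<or>
     exponent (I_poly \<alpha>) = exponent (I_poly \<gamma>) \<and> mantissa (I_poly \<alpha>) > mantissa (I_poly \<gamma>)"

definition sim1 :: "bits \<Rightarrow> bits \<Rightarrow> bool" where
  "sim1 \<alpha> \<gamma> \<longleftrightarrow> sim0 (complement \<alpha>) (complement \<gamma>)"

text \<open>Complementation reverses the order, so the arguments are swapped on the right.\<close>

definition gt1 :: "bits \<Rightarrow> bits \<Rightarrow> bool" where
  "gt1 \<alpha> \<gamma> \<longleftrightarrow> gt0 (complement \<gamma>) (complement \<alpha>)"

lemma bij_betw_I_bit: "bij_betw (poly (I_bit a)) {0..1} {0..1}"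
proof (rule bij_betw_byWitness[where f' = "\<lambda>y. if a then 1 - sqrt (1 - y) else sqrt y"])
qed (auto simp: I_bit_def power_le_one)

lemma bij_betw_I_poly: "bij_betw (poly (I_poly \<alpha>)) {0..1} {0..1}"
proof (induction \<alpha>)
  case Nil
  have "poly (I_poly []) = id" by (auto simp: fun_eq_iff)
  then show ?case by (simp only: bij_betw_id)
next
  case (Cons a \<alpha>)
  have "poly (I_poly (a # \<alpha>)) = poly (I_poly \<alpha>) \<circ> poly (I_bit a)"
    by (auto simp: fun_eq_iff poly_pcompose)
  with bij_betw_trans[OF bij_betw_I_bit Cons] show ?case by (simp only:)
qed

definition hlf :: "bits \<Rightarrow> real" where
  "hlf \<alpha> = the_inv_into {0..1} (poly (I_poly \<alpha>)) (1/2)"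

definition ge_hlf :: "bits \<Rightarrow> bits \<Rightarrow> bool" where
  "ge_hlf \<alpha> \<gamma> \<longleftrightarrow> hlf \<alpha> \<le> hlf \<gamma>"

definition ge_fst :: "bits \<Rightarrow> bits \<Rightarrow> bool" where
  "ge_fst \<alpha> \<gamma> \<longleftrightarrow>
     (gt0 \<alpha> \<gamma> \<or> sim0 \<alpha> \<gamma>) \<and> (gt1 \<alpha> \<gamma> \<or> sim1 \<alpha> \<gamma>) \<and> ge_hlf \<alpha> \<gamma>"

end

theory Submission imports Defs begin

text \<open>If \<open>f \<ge> g\<close> on \<open>[0, 1]\<close>, then the lowest nonvanishing coefficient of \<open>f - g\<close> is
  nonnegative, since near 0 the difference has the sign of that coefficient. The exponent is the
  index, and the mantissa the value, of the lowest nonvanishing coefficient, which gives the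
  comparison at 0. The comparison at 1 reduces to it because
  \<open>1 - I(1 - x)\<close> is the polynomial of the complementary string. The halfway points compare because
  the larger of two increasing functions reaches \<open>1/2\<close> first.\<close>

lemma lowest_coeff_nonneg:
  fixes f :: "real poly"
  assumes nonneg: "\<And>x. x \<in> {0..1} \<Longrightarrow> poly f x \<ge> 0" and "\<forall>i<e. coeff f i = 0"
  shows "coeff f e \<ge> 0"
proof -
  \<comment> \<open>Dividing by x^e keeps the sign on (0, 1), and \<open>poly h 0\<close> is the
    coefficient in question; a one-sided limit at 0 then carries the sign over.\<close>
  obtain h where h: "f = monom 1 e * h"
    using assms(2) monom_1_dvd_iff'[of e f] by (auto elim: dvdE)
  have "((\<lambda>x. poly h x) \<longlongrightarrow> poly h 0) (at_right 0)"
    by (intro tendsto_intros)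
  moreover have "eventually (\<lambda>x. poly h x \<ge> 0) (at_right 0)"
    unfolding eventually_at_right_field
  proof (intro exI[of _ 1] conjI allI impI)
    fix x :: real
    assume "0 < x" "x < 1"
    then show "poly h x \<ge> 0"
      using nonneg[of x] zero_less_power[of x e]
      by (simp add: h poly_monom zero_le_mult_iff del: zero_less_power)
  qed simp
  ultimately have "poly h 0 \<ge> 0"
    by (rule tendsto_lowerbound) simp
  then show ?thesis
    by (simp add: h coeff_monom_mult poly_0_coeff_0)
qed

lemma has_exponent_mantissa_exponent_mantissa:
  assumes "f \<noteq> 0"
  shows "has_exponent_mantissa f (exponent f) (mantissa f)"
proof -
  obtain e m where em: "has_exponent_mantissa f e m"
    using ex1_exponent[OF assms] by blast
  moreover have "exponent f = e" "mantissa f = m"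
    unfolding exponent_def mantissa_def
    using em has_exponent_mantissa_unique by (blast intro: the_equality)+
  ultimately show ?thesis by simp
qed

lemma exponent_mantissa_mono:
  assumes "f \<noteq> 0" "g \<noteq> 0"
    and g: "\<And>x. x \<in> {0..1} \<Longrightarrow> poly g x \<ge> 0"
    and fg: "\<And>x. x \<in> {0..1} \<Longrightarrow> poly f x \<ge> poly g x"
  shows "exponent f < exponent g \<or> exponent f = exponent g \<and> mantissa f \<ge> mantissa g"
proof (rule ccontr)
  note F = has_exponent_mantissa_coeff[OF has_exponent_mantissa_exponent_mantissa[OF assms(1)]]
    and G = has_exponent_mantissa_coeff[OF has_exponent_mantissa_exponent_mantissa[OF assms(2)]]
  assume "\<not> ?thesis"
  then have less: "exponent f > exponent g \<or> exponent f = exponent g \<and> mantissa f < mantissa g"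
    by linarith
  \<comment> \<open>At index \<open>exponent g\<close> the difference has coefficient
    \<open>- mantissa g\<close> if f has the larger exponent, and
    \<open>mantissa f - mantissa g\<close> otherwise. The first case needs this positivity.\<close>
  have "mantissa g > 0"
    using lowest_coeff_nonneg[OF g G(3)] G(1,2) by simp
  then have "coeff (f - g) (exponent g) < 0"
    using less F G by auto
  moreover have "\<forall>i<exponent g. coeff (f - g) i = 0"
    using less F G by auto
  then have "coeff (f - g) (exponent g) \<ge> 0"
    by (intro lowest_coeff_nonneg) (use fg in auto)
  ultimately show False by simp
qed

lemma poly_I_poly_in: "x \<in> {0..1} \<Longrightarrow> poly (I_poly \<alpha>) x \<in> {0..1}"
  using bij_betw_I_poly[of \<alpha>] by (blast dest: bij_betwE)

lemma I_poly_nonzero: "I_poly \<alpha> \<noteq> 0"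
proof
  assume "I_poly \<alpha> = 0"
  moreover have "(1::real) \<in> poly (I_poly \<alpha>) ` {0..1}"
    using bij_betw_imp_surj_on[OF bij_betw_I_poly[of \<alpha>]] by simp
  ultimately show False by auto
qed

lemma rel_ge_imp_gt0_or_sim0:
  assumes "rel_ge \<alpha> \<gamma>"
  shows "gt0 \<alpha> \<gamma> \<or> sim0 \<alpha> \<gamma>"
proof -
  have "exponent (I_poly \<alpha>) < exponent (I_poly \<gamma>) \<or>
    exponent (I_poly \<alpha>) = exponent (I_poly \<gamma>) \<and> mantissa (I_poly \<alpha>) \<ge> mantissa (I_poly \<gamma>)"
    using assms poly_I_poly_in[of _ \<gamma>]
    by (intro exponent_mantissa_mono I_poly_nonzero) (auto simp: rel_ge_def)
  then show ?thesis by (auto simp: gt0_def sim0_def)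
qed

text \<open>Conjugation by x -> 1 - x exchanges the two one-bit polynomials and is compatible with
  composition.\<close>

lemma poly_I_poly_complement:
  "poly (I_poly (complement \<alpha>)) x = 1 - poly (I_poly \<alpha>) (1 - x)"
proof (induction \<alpha> arbitrary: x)
  case (Cons a \<alpha>)
  have "1 - poly (I_bit (\<not> a)) x = poly (I_bit a) (1 - x)"
    by (simp add: I_bit_def)
  with Cons show ?case by (simp add: complement_def poly_pcompose)
qed (simp add: complement_def)

text \<open>The inner reflection preserves [0, 1] and the outer one reverses the inequality, hence
  the swapped arguments.\<close>

lemma rel_ge_complement: "rel_ge \<alpha> \<gamma> \<Longrightarrow> rel_ge (complement \<gamma>) (complement \<alpha>)"
  by (auto simp: rel_ge_def poly_I_poly_complement)

lemma strict_mono_on_I_bit: "strict_mono_on {0..1} (poly (I_bit a))"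
  by (rule strict_mono_onI) (auto simp: I_bit_def power_strict_mono)

lemma strict_mono_on_I_poly: "strict_mono_on {0..1} (poly (I_poly \<alpha>))"
proof (induction \<alpha>)
  case (Cons a \<alpha>)
  show ?case
  proof (rule strict_mono_onI)
    fix x y :: real
    assume "x \<in> {0..1}" "y \<in> {0..1}" "x < y"
    then show "poly (I_poly (a # \<alpha>)) x < poly (I_poly (a # \<alpha>)) y"
      \<comment> \<open>Bijectivity of \<open>I_bit\<close> keeps the intermediate values in [0, 1],
        where the induction hypothesis applies.\<close>
      using strict_mono_onD[OF strict_mono_on_I_bit[of a], of x y]
        bij_betwE[OF bij_betw_I_bit[of a]]
      by (auto simp: poly_pcompose intro!: strict_mono_onD[OF Cons])
  qed
qed (auto intro: strict_mono_onI)

lemma hlf_in: "hlf \<alpha> \<in> {0..1}"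
  and poly_I_poly_hlf: "poly (I_poly \<alpha>) (hlf \<alpha>) = 1/2"
proof -
  note bij = bij_betw_I_poly[of \<alpha>]
  have half: "(1/2 :: real) \<in> poly (I_poly \<alpha>) ` {0..1}"
    using bij_betw_imp_surj_on[OF bij] by simp
  show "hlf \<alpha> \<in> {0..1}"
    unfolding hlf_def by (rule the_inv_into_into[OF bij_betw_imp_inj_on[OF bij] half order_refl])
  show "poly (I_poly \<alpha>) (hlf \<alpha>) = 1/2"
    unfolding hlf_def by (rule f_the_inv_into_f[OF bij_betw_imp_inj_on[OF bij] half])
qed

lemma rel_ge_imp_ge_hlf:
  assumes "rel_ge \<alpha> \<gamma>"
  shows "ge_hlf \<alpha> \<gamma>"
  unfolding ge_hlf_def
proof (rule ccontr)
  assume "\<not> hlf \<alpha> \<le> hlf \<gamma>"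
  \<comment> \<open>At \<open>hlf \<gamma>\<close> the polynomial of \<alpha> would lie below 1/2,
    the value there of the polynomial it dominates.\<close>
  then have "poly (I_poly \<alpha>) (hlf \<gamma>) < poly (I_poly \<alpha>) (hlf \<alpha>)"
    by (intro strict_mono_onD[OF strict_mono_on_I_poly] hlf_in) simp
  moreover have "poly (I_poly \<gamma>) (hlf \<gamma>) \<le> poly (I_poly \<alpha>) (hlf \<gamma>)"
    using assms hlf_in unfolding rel_ge_def by blast
  ultimately show False by (simp add: poly_I_poly_hlf)
qed

theorem proposition45:
  fixes \<alpha> \<gamma> :: bits
  assumes "rel_ge \<alpha> \<gamma>"
  shows "ge_fst \<alpha> \<gamma>"
proof -
  \<comment> \<open>\<open>gt1\<close> swaps its arguments but \<open>sim1\<close> does not; the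
    symmetry of \<open>sim0\<close> reconciles them.\<close>
  have "gt1 \<alpha> \<gamma> \<or> sim1 \<alpha> \<gamma>"
    using rel_ge_imp_gt0_or_sim0[OF rel_ge_complement[OF assms]]
    by (auto simp: gt1_def sim1_def sim0_def)
  then show ?thesis
    using rel_ge_imp_gt0_or_sim0[OF assms] rel_ge_imp_ge_hlf[OF assms] by (simp add: ge_fst_def)
qed

end
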